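(* Let $\sigma$ be a reduced, indecomposable and $1324$-avoiding permutation of length $s\ge2$, let $I(\sigma)=\{1,\,s,\,\sigma^{-1}(1),\,\sigma^{-1}(s)\}$ (a set of positions), and put $$D(\sigma)=\{\,i\in I(\sigma):\ \sigma\setminus i\text{ is decomposable, or }s=2\,\}.$$ Then for every $b\in\mathbb{Z}_{\ge1}^s$ with $\sum_i b_i=n\ge3$ and every integer $\delta$, $$\sigma[b]\in\mathcal{R}_{\delta,n}\iff \sum_{(i,j)\in\mathrm{Inv}(\sigma)}b_ib_j=2n-7+\delta\ \text{ and }\ b_i\ge2\text{ for every }i\in D(\sigma).$$ Consequently, for $n\ge3$, $\mathcal{R}_{\delta,n}$ is the disjoint union, over reduced, indecomposable, $1324$-avoiding $\sigma$ of length at least $2$, of the sets of inflations $\sigma[b]$ (with $\sum_i b_i=n$) so described.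
   Context: Permutations are written in one-line notation $\pi=\pi_1\cdots\pi_n$, and $\operatorname{inv}(\pi)$ is the number of pairs $i<j$ with $\pi_i>\pi_j$. A permutation avoids $1324$ if there are no indices $i_1<i_2<i_3<i_4$ with $\pi_{i_1}<\pi_{i_3}<\pi_{i_2}<\pi_{i_4}$. $\mathrm{Av}_n^k(1324)$ is the set of $1324$-avoiding permutations of length $n$ with exactly $k$ inversions. A permutation of length $n$ is decomposable if for some $1\le j<n$ its first $j$ entries are exactly $\{1,\dots,j\}$; otherwise it is indecomposable. $\pi\setminus x$ is obtained by deleting the entry $x$ and standardizing. An indecomposable $\pi$ of length $n$ is almost decomposable if at least one of $\pi\setminus 1$, $\pi\setminus n$, $\pi\setminus\pi_1$, $\pi\setminus\pi_n$ (deleting the smallest, largest, first, last entry) is decomposable. The set of residuals at defect $\delta$ is $$\mathcal{R}_{\delta,n}=\{\pi\in\mathrm{Av}_n^{2n-7+\delta}(1324):\ \pi\text{ is indecomposable and not almost decomposable}\}.$$ For a permutation $\tau$ of length $t$ and $b\in\mathbb{Z}_{\ge1}^t$, $\tau[b]$ is the inflation of $\tau$ in which the $i$th entry is replaced by an increasing run of $b_i$ entries occupying consecutive positions and consecutive values, the blocks being in the relative order of $\tau$. $\sigma$ is reduced if $\sigma_{i+1}\ne\sigma_i+1$ for all $1\le i<|\sigma|$. $\mathrm{Inv}(\tau)=\{(i,j):i<j,\ \tau_i>\tau_j\}$. For a position $i$ of $\sigma$, $\sigma\setminus i$ means: delete the entry at position $i$ and standardize. *)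

theory Defs
  imports "HOL-Combinatorics.Multiset_Permutations" "HOL-Library.Disjoint_Sets"
begin

text \<open>
  A permutation of length n is given in one-line notation, as a list in
  \<open>permutations_of_set {1..n}\<close>. Its entries are \<open>1, ..., n\<close>, but its positions are those
  of the list, \<open>0, ..., n - 1\<close>; so the first entry is \<open>\<pi> ! 0\<close> and the last is
  \<open>\<pi> ! (n - 1)\<close>.
\<close>

definition inversions :: "nat list \<Rightarrow> (nat \<times> nat) set" where
  "inversions \<pi> = {(i, j). i < j \<and> j < length \<pi> \<and> \<pi> ! i > \<pi> ! j}"

definition inversion_number :: "nat list \<Rightarrow> nat" where
  "inversion_number \<pi> = card (inversions \<pi>)"

definition avoids_1324 :: "nat list \<Rightarrow> bool" where
  "avoids_1324 \<pi> \<longleftrightarrow>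
     \<not> (\<exists>i1 i2 i3 i4. i1 < i2 \<and> i2 < i3 \<and> i3 < i4 \<and> i4 < length \<pi> \<and>
          \<pi> ! i1 < \<pi> ! i3 \<and> \<pi> ! i3 < \<pi> ! i2 \<and> \<pi> ! i2 < \<pi> ! i4)"

text \<open>The number of inversions is an integer parameter, because it is instantiated
  with \<open>2 n - 7 + \<delta>\<close>, which may be negative (the set is then empty).\<close>

definition Av_1324 :: "nat \<Rightarrow> int \<Rightarrow> nat list set" where
  "Av_1324 n k =
     {\<pi> \<in> permutations_of_set {1..n}. avoids_1324 \<pi> \<and> int (inversion_number \<pi>) = k}"

definition decomposable :: "nat list \<Rightarrow> bool" where
  "decomposable \<pi> \<longleftrightarrow> (\<exists>j. 1 \<le> j \<and> j < length \<pi> \<and> set (take j \<pi>) = {1..j})"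

definition standardize :: "nat list \<Rightarrow> nat list" where
  "standardize xs = map (\<lambda>x. card {y \<in> set xs. y \<le> x}) xs"

definition delete_entry :: "nat \<Rightarrow> nat list \<Rightarrow> nat list" where
  "delete_entry x \<pi> = standardize (removeAll x \<pi>)"

definition delete_position :: "nat \<Rightarrow> nat list \<Rightarrow> nat list" where
  "delete_position i \<pi> = standardize (take i \<pi> @ drop (Suc i) \<pi>)"

definition almost_decomposable :: "nat list \<Rightarrow> bool" where
  "almost_decomposable \<pi> \<longleftrightarrow> \<not> decomposable \<pi> \<and>
     (decomposable (delete_entry 1 \<pi>) \<or>
      decomposable (delete_entry (length \<pi>) \<pi>) \<or>
      decomposable (delete_entry (hd \<pi>) \<pi>) \<or>
      decomposable (delete_entry (last \<pi>) \<pi>))"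

definition residuals :: "int \<Rightarrow> nat \<Rightarrow> nat list set" where
  "residuals \<delta> n =
     {\<pi> \<in> Av_1324 n (2 * int n - 7 + \<delta>). \<not> decomposable \<pi> \<and> \<not> almost_decomposable \<pi>}"

text \<open>The block replacing the entry at position \<open>i\<close> takes the consecutive values that
  follow \<open>block_offset \<tau> b i\<close>, the total size of the blocks replacing smaller entries.\<close>

definition block_offset :: "nat list \<Rightarrow> nat list \<Rightarrow> nat \<Rightarrow> nat" where
  "block_offset \<tau> b i = (\<Sum>j \<in> {j. j < length \<tau> \<and> \<tau> ! j < \<tau> ! i}. b ! j)"

definition inflation :: "nat list \<Rightarrow> nat list \<Rightarrow> nat list" where
  "inflation \<tau> b =
     concat (map (\<lambda>i. [block_offset \<tau> b i + 1 ..< block_offset \<tau> b i + b ! i + 1])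
                 [0..<length \<tau>])"

definition reduced :: "nat list \<Rightarrow> bool" where
  "reduced \<sigma> \<longleftrightarrow> (\<forall>i. Suc i < length \<sigma> \<longrightarrow> \<sigma> ! Suc i \<noteq> \<sigma> ! i + 1)"

definition reduced_bases :: "nat list set" where
  "reduced_bases =
     {\<sigma>. \<sigma> \<in> permutations_of_set {1..length \<sigma>} \<and> 2 \<le> length \<sigma> \<and>
         reduced \<sigma> \<and> \<not> decomposable \<sigma> \<and> avoids_1324 \<sigma>}"

definition extremal_positions :: "nat list \<Rightarrow> nat set" where
  "extremal_positions \<sigma> =
     {0, length \<sigma> - 1,
      inv_into {..<length \<sigma>} (nth \<sigma>) 1,
      inv_into {..<length \<sigma>} (nth \<sigma>) (length \<sigma>)}"

definition critical_positions :: "nat list \<Rightarrow> nat set" where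
  "critical_positions \<sigma> =
     {i \<in> extremal_positions \<sigma>. decomposable (delete_position i \<sigma>) \<or> length \<sigma> = 2}"

definition block_sizes :: "nat list \<Rightarrow> nat \<Rightarrow> nat list set" where
  "block_sizes \<sigma> n =
     {b. length b = length \<sigma> \<and> (\<forall>i < length b. 1 \<le> b ! i) \<and> sum_list b = n}"

definition residual_inflations :: "int \<Rightarrow> nat \<Rightarrow> nat list \<Rightarrow> nat list set" where
  "residual_inflations \<delta> n \<sigma> =
     {inflation \<sigma> b | b. b \<in> block_sizes \<sigma> n \<and>
        int (\<Sum>(i, j) \<in> inversions \<sigma>. b ! i * b ! j) = 2 * int n - 7 + \<delta> \<and>
        (\<forall>i \<in> critical_positions \<sigma>. 2 \<le> b ! i)}"

end

theory Submission
  imports Defs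
begin

text \<open>
  An inflation \<open>\<pi>\<close> of \<open>\<sigma>\<close> comes with a monotone surjection \<open>p\<close> from the positions of \<open>\<pi>\<close> onto
  those of \<open>\<sigma>\<close>, sending a position to its block, such that for \<open>k < l\<close> the entries of \<open>\<pi>\<close>
  increase from \<open>k\<close> to \<open>l\<close> iff \<open>\<sigma> ! p k \<le> \<sigma> ! p l\<close>. Such a block map determines the
  inflation (\<open>block_map_imp_inflation\<close>), so all arguments are about block maps.

  Along a block map every property in the definition of a residual is read off from \<open>\<sigma>\<close> and
  the block sizes. Occurrences of 1324 meet four different blocks
  (\<open>block_map_avoids_1324_iff\<close>); inversions are pairs from two inverted blocks
  (\<open>block_map_inversion_number\<close>); and over a base of length at least two, decomposability
  is inherited in both directions (\<open>block_map_decomposable_iff\<close>). The block map sends the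
  four extremal positions of \<open>\<pi>\<close> to those of \<open>\<sigma>\<close>. Deleting an entry of \<open>\<pi>\<close> shrinks its block,
  and if the block had size one, deletes it from \<open>\<sigma>\<close>; hence the deletion is decomposable
  exactly if the block has size one and either \<open>\<sigma>\<close> without this entry is decomposable or
  \<open>\<sigma>\<close> has length two, in which case one increasing block of length at least two is left
  (\<open>block_map_delete_position_iff\<close>). This gives the characterization of the residual
  inflations of a base.

  Every permutation is an inflation of a reduced one, by repeatedly contracting adjacent
  entries with consecutive values (\<open>reduced_base_exists\<close>). The reduced base is unique because
  its blocks are the maximal runs of consecutive values (\<open>block_map_Suc_eq_iff\<close>,
  \<open>reduced_base_unique\<close>). An indecomposable permutation of length at least two is not
  increasing, so its base has length at least two.
\<close>

section \<open>Permutations in one-line notation\<close>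

abbreviation is_perm :: "nat list \<Rightarrow> bool" where
  "is_perm \<pi> \<equiv> \<pi> \<in> permutations_of_set {1..length \<pi>}"

lemma is_permD:
  assumes "is_perm \<pi>"
  shows "distinct \<pi>" "set \<pi> = {1..length \<pi>}"
  using assms by (auto simp: permutations_of_set_def)

lemma is_permI: "distinct \<pi> \<Longrightarrow> set \<pi> = {1..length \<pi>} \<Longrightarrow> is_perm \<pi>"
  by (auto simp: permutations_of_set_def)

lemma is_perm_nth_bounds:
  assumes "is_perm \<pi>" "k < length \<pi>"
  shows "1 \<le> \<pi> ! k" "\<pi> ! k \<le> length \<pi>"
  using nth_mem[OF assms(2)] is_permD[OF assms(1)] by auto

lemma is_perm_obtain:
  assumes "is_perm \<pi>" "1 \<le> v" "v \<le> length \<pi>"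
  obtains k where "k < length \<pi>" "\<pi> ! k = v"
  using assms is_permD[OF assms(1)] by (metis atLeastAtMost_iff in_set_conv_nth)

lemma is_perm_nth_eq_iff:
  assumes "is_perm \<pi>" "k < length \<pi>" "l < length \<pi>"
  shows "\<pi> ! k = \<pi> ! l \<longleftrightarrow> k = l"
  using is_permD[OF assms(1)] assms nth_eq_iff_index_eq by blast

text \<open>A permutation is determined by the comparisons of its entries, as each entry is its
  own rank.\<close>

lemma is_perm_eqI:
  assumes "is_perm \<pi>" "is_perm \<rho>" "length \<pi> = length \<rho>"
    and cmp: "\<And>k l. k < l \<Longrightarrow> l < length \<pi> \<Longrightarrow> \<pi> ! k < \<pi> ! l \<longleftrightarrow> \<rho> ! k < \<rho> ! l"
  shows "\<pi> = \<rho>"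
proof (rule nth_equalityI[OF assms(3)])
  have rank: "\<tau> ! k = card {l. l < length \<tau> \<and> \<tau> ! l \<le> \<tau> ! k}"
    if \<tau>: "is_perm \<tau>" "k < length \<tau>" for \<tau> k
  proof -
    have "(!) \<tau> ` {l. l < length \<tau> \<and> \<tau> ! l \<le> \<tau> ! k} = {1..\<tau> ! k}" (is "?L = _")
    proof
      show "?L \<subseteq> {1..\<tau> ! k}"
        using is_perm_nth_bounds[OF \<tau>(1)] by auto
      show "{1..\<tau> ! k} \<subseteq> ?L"
      proof
        fix v assume v: "v \<in> {1..\<tau> ! k}"
        then have "1 \<le> v" "v \<le> length \<tau>"
          using is_perm_nth_bounds[OF \<tau>] by auto
        then obtain m where "m < length \<tau>" "\<tau> ! m = v"
          using is_perm_obtain[OF \<tau>(1)] by blast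
        then show "v \<in> ?L" using v by auto
      qed
    qed
    moreover have "inj_on ((!) \<tau>) {l. l < length \<tau> \<and> \<tau> ! l \<le> \<tau> ! k}"
      using is_permD[OF \<tau>(1)] by (auto simp: inj_on_def nth_eq_iff_index_eq)
    ultimately show ?thesis
      by (metis card_atLeastAtMost card_image diff_Suc_1)
  qed
  fix k assume k: "k < length \<pi>"
  have "\<pi> ! l \<le> \<pi> ! k \<longleftrightarrow> \<rho> ! l \<le> \<rho> ! k" if l: "l < length \<pi>" for l
  proof (cases l k rule: linorder_cases)
    case less
    then show ?thesis
      using cmp[OF less k] is_perm_nth_eq_iff[OF assms(1) l k]
        is_perm_nth_eq_iff[OF assms(2), of l k] l k assms(3) by (simp add: le_less)
  next
    case greater
    then show ?thesis using cmp[OF greater l] by (simp add: not_less[symmetric])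
  qed simp
  then have "{l. l < length \<pi> \<and> \<pi> ! l \<le> \<pi> ! k} = {l. l < length \<rho> \<and> \<rho> ! l \<le> \<rho> ! k}"
    using assms(3) by auto
  then show "\<pi> ! k = \<rho> ! k"
    using rank[OF assms(1) k] rank[OF assms(2)] k assms(3) by simp
qed

lemma length_standardize [simp]: "length (standardize xs) = length xs"
  by (simp add: standardize_def)

lemma standardize_nth_less_iff:
  assumes "k < length xs" "l < length xs"
  shows "standardize xs ! k < standardize xs ! l \<longleftrightarrow> xs ! k < xs ! l"
proof -
  have le: "card {y \<in> set xs. y \<le> u} \<le> card {y \<in> set xs. y \<le> v}" if "u \<le> v" for u v
    using that by (intro card_mono) auto
  have "card {y \<in> set xs. y \<le> u} < card {y \<in> set xs. y \<le> v}"
    if "u < v" "v \<in> set xs" for u v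
  proof (rule psubset_card_mono)
    have "v \<notin> {y \<in> set xs. y \<le> u}" "v \<in> {y \<in> set xs. y \<le> v}" using that by auto
    then show "{y \<in> set xs. y \<le> u} \<subset> {y \<in> set xs. y \<le> v}" using that(1) by fastforce
  qed auto
  then show ?thesis
    using assms le[of "xs ! l" "xs ! k"] by (auto simp: standardize_def not_less[symmetric])
qed

lemma is_perm_standardize:
  assumes "distinct xs"
  shows "is_perm (standardize xs)"
proof (rule is_permI)
  show d: "distinct (standardize xs)"
    unfolding distinct_conv_nth
  proof (intro allI impI)
    fix i j assume ij: "i < length (standardize xs)" "j < length (standardize xs)" "i \<noteq> j"
    then have "xs ! i < xs ! j \<or> xs ! j < xs ! i"
      using assms by (metis length_standardize linorder_neqE_nat nth_eq_iff_index_eq)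
    then show "standardize xs ! i \<noteq> standardize xs ! j"
      using standardize_nth_less_iff[of i xs j] standardize_nth_less_iff[of j xs i] ij by auto
  qed
  have "set (standardize xs) \<subseteq> {1..length xs}"
  proof -
    have "1 \<le> card {y \<in> set xs. y \<le> x}" if "x \<in> set xs" for x
      using that card_gt_0_iff[of "{y \<in> set xs. y \<le> x}"] by (auto simp: Suc_le_eq)
    moreover have "card {y \<in> set xs. y \<le> x} \<le> length xs" for x
      using card_mono[of "set xs" "{y \<in> set xs. y \<le> x}"] card_length[of xs] by auto
    ultimately show ?thesis by (auto simp: standardize_def)
  qed
  moreover have "card (set (standardize xs)) = length xs"
    using distinct_card[OF d] by simp
  ultimately show "set (standardize xs) = {1..length (standardize xs)}"
    by (simp add: card_subset_eq)
qed

section \<open>Decomposability as a cut of a set of positions\<close>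

text \<open>The entries \<open>f k\<close> with \<open>k \<in> A\<close>, read from left to right, form a decomposable
  pattern: a cut \<open>c\<close> splits the positions into two nonempty parts such that every entry
  of the left part is smaller than every entry of the right part. No standardization is
  needed in this form, so that deleting an entry amounts to removing a position from \<open>A\<close>.\<close>

definition splits :: "(nat \<Rightarrow> nat) \<Rightarrow> nat set \<Rightarrow> bool" where
  "splits f A \<longleftrightarrow> (\<exists>c. (\<exists>k\<in>A. k < c) \<and> (\<exists>k\<in>A. c \<le> k) \<and>
     (\<forall>k\<in>A. \<forall>l\<in>A. k < c \<and> c \<le> l \<longrightarrow> f k < f l))"

lemma splits_cong:
  assumes "\<And>k l. k \<in> A \<Longrightarrow> l \<in> A \<Longrightarrow> k < l \<Longrightarrow> f k < f l \<longleftrightarrow> g k < g l"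
  shows "splits f A \<longleftrightarrow> splits g A"
  unfolding splits_def using assms by (meson less_le_trans)

text \<open>Re-indexing the positions; applied to the map that skips a deleted position.\<close>

lemma splits_strict_mono_image:
  fixes e :: "nat \<Rightarrow> nat"
  assumes "strict_mono e"
  shows "splits (\<lambda>m. f (e m)) A \<longleftrightarrow> splits f (e ` A)"
proof
  assume "splits (\<lambda>m. f (e m)) A"
  then obtain c where "\<exists>k\<in>A. k < c" "\<exists>k\<in>A. c \<le> k"
    "\<forall>k\<in>A. \<forall>l\<in>A. k < c \<and> c \<le> l \<longrightarrow> f (e k) < f (e l)"
    unfolding splits_def by blast
  then show "splits f (e ` A)"
    unfolding splits_def using assms
    by (intro exI[of _ "e c"]) (auto simp: strict_mono_less strict_mono_less_eq)
next
  assume "splits f (e ` A)"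
  then obtain c where c: "\<exists>k\<in>A. e k < c" "\<exists>k\<in>A. c \<le> e k"
    "\<forall>k\<in>A. \<forall>l\<in>A. e k < c \<and> c \<le> e l \<longrightarrow> f (e k) < f (e l)"
    unfolding splits_def by auto
  \<comment> \<open>The cut \<open>c\<close> need not be in the range of \<open>e\<close>; its counterpart is the first index past it.\<close>
  define d where "d = (LEAST m. c \<le> e m)"
  have "c \<le> e d" unfolding d_def using c(2) by (metis (lifting) LeastI)
  then have "m < d \<longleftrightarrow> e m < c" for m
    using assms strict_mono_less_eq[OF assms, of d m]
    by (metis (lifting) d_def dual_order.trans not_less not_less_Least)
  then show "splits (\<lambda>m. f (e m)) A"
    unfolding splits_def using c by (intro exI[of _ d]) (auto simp: not_less[symmetric])
qed

lemma decomposable_iff_splits: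
  assumes "is_perm \<pi>"
  shows "decomposable \<pi> \<longleftrightarrow> splits ((!) \<pi>) {..<length \<pi>}"
proof
  assume "decomposable \<pi>"
  then obtain j where j: "1 \<le> j" "j < length \<pi>" "set (take j \<pi>) = {1..j}"
    by (auto simp: decomposable_def)
  have "\<pi> ! k < \<pi> ! l" if kl: "k < j" "j \<le> l" "l < length \<pi>" for k l
  proof -
    have "\<pi> ! k \<in> set (take j \<pi>)"
      using nth_mem[of k "take j \<pi>"] kl j by simp
    moreover have "\<pi> ! l \<notin> set (take j \<pi>)"
    proof
      assume "\<pi> ! l \<in> set (take j \<pi>)"
      then obtain m where "m < j" "\<pi> ! m = \<pi> ! l"
        by (auto simp only: in_set_conv_nth length_take min_less_iff_conj nth_take)
      then show False using is_perm_nth_eq_iff[OF assms, of m l] kl by auto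
    qed
    ultimately show ?thesis
      using j is_perm_nth_bounds[OF assms kl(3)] by auto
  qed
  then show "splits ((!) \<pi>) {..<length \<pi>}"
    unfolding splits_def using j by (intro exI[of _ j]) (auto simp: Suc_le_eq)
next
  assume "splits ((!) \<pi>) {..<length \<pi>}"
  then obtain c where c: "\<exists>k<length \<pi>. k < c" "\<exists>k<length \<pi>. c \<le> k"
    "\<And>k l. k < length \<pi> \<Longrightarrow> l < length \<pi> \<Longrightarrow> k < c \<Longrightarrow> c \<le> l \<Longrightarrow> \<pi> ! k < \<pi> ! l"
    unfolding splits_def Bex_def Ball_def lessThan_iff by blast
  have c': "1 \<le> c" "c < length \<pi>" using c by auto
  have sub: "set (take c \<pi>) \<subseteq> {1..c}"
  proof
    fix v assume v: "v \<in> set (take c \<pi>)"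
    then obtain k where k: "k < c" "v = \<pi> ! k"
      using c' by (auto simp: in_set_conv_nth)
    \<comment> \<open>Every value up to an entry left of the cut sits left of the cut.\<close>
    have "{1..v} \<subseteq> set (take c \<pi>)"
    proof
      fix w assume w: "w \<in> {1..v}"
      then have "1 \<le> w" "w \<le> length \<pi>"
        using is_perm_nth_bounds[OF assms, of k] k c' by auto
      then obtain m where m: "m < length \<pi>" "\<pi> ! m = w"
        using is_perm_obtain[OF assms] by blast
      have "m < c" using c(3)[of k m] m w k c' by (auto simp: not_le[symmetric])
      then show "w \<in> set (take c \<pi>)"
        using m c' by (auto simp: in_set_conv_nth)
    qed
    then have "card {1..v} \<le> card (set (take c \<pi>))" by (intro card_mono) auto
    also have "\<dots> \<le> c" using card_length[of "take c \<pi>"] by simp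
    finally show "v \<in> {1..c}"
      using is_perm_nth_bounds[OF assms, of k] k c' by auto
  qed
  have "card (set (take c \<pi>)) = c"
    using distinct_card[of "take c \<pi>"] is_permD[OF assms] c' by simp
  then have "set (take c \<pi>) = {1..c}" using sub by (simp add: card_subset_eq)
  then show "decomposable \<pi>" unfolding decomposable_def using c' by blast
qed

lemma length_delete_position:
  "i < length \<pi> \<Longrightarrow> length (delete_position i \<pi>) = length \<pi> - 1"
  by (simp add: delete_position_def)

lemma is_perm_delete_position:
  assumes "distinct \<pi>"
  shows "is_perm (delete_position i \<pi>)"
proof -
  have "distinct (take i \<pi> @ drop (Suc i) \<pi>)"
    using assms set_take_disj_set_drop_if_distinct[OF assms, of i "Suc i"] by simp
  then show ?thesis unfolding delete_position_def by (rule is_perm_standardize)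
qed

lemma delete_position_nth_less_iff:
  assumes "i < length \<pi>" "k < length \<pi> - 1" "l < length \<pi> - 1"
  defines "e \<equiv> (\<lambda>m. if m < i then m else Suc m)"
  shows "delete_position i \<pi> ! k < delete_position i \<pi> ! l \<longleftrightarrow> \<pi> ! e k < \<pi> ! e l"
proof -
  have "(take i \<pi> @ drop (Suc i) \<pi>) ! m = \<pi> ! e m" if "m < length \<pi> - 1" for m
    using that assms(1) by (auto simp: nth_append e_def min_def)
  then show ?thesis
    unfolding delete_position_def using assms by (subst standardize_nth_less_iff) auto
qed

lemma decomposable_delete_position_iff:
  assumes "distinct \<pi>" "i < length \<pi>"
  shows "decomposable (delete_position i \<pi>) \<longleftrightarrow> splits ((!) \<pi>) ({..<length \<pi>} - {i})"
proof -
  define e where "e m = (if m < i then m else Suc m)" for m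
  have e: "strict_mono e" by (auto simp: strict_mono_def e_def)
  have img: "e ` {..<length \<pi> - 1} = {..<length \<pi>} - {i}"
  proof
    show "e ` {..<length \<pi> - 1} \<subseteq> {..<length \<pi>} - {i}" by (auto simp: e_def)
    show "{..<length \<pi>} - {i} \<subseteq> e ` {..<length \<pi> - 1}"
    proof
      fix k assume "k \<in> {..<length \<pi>} - {i}"
      then show "k \<in> e ` {..<length \<pi> - 1}"
        using assms(2)
        by (intro image_eqI[of _ _ "if k < i then k else k - 1"]) (auto simp: e_def)
    qed
  qed
  have "decomposable (delete_position i \<pi>) \<longleftrightarrow>
      splits ((!) (delete_position i \<pi>)) {..<length \<pi> - 1}"
    using decomposable_iff_splits[OF is_perm_delete_position[OF assms(1)]]
    by (simp add: length_delete_position assms)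
  also have "\<dots> \<longleftrightarrow> splits (\<lambda>m. \<pi> ! e m) {..<length \<pi> - 1}"
    by (rule splits_cong)
      (use delete_position_nth_less_iff[OF assms(2)] in \<open>auto simp: e_def\<close>)
  also have "\<dots> \<longleftrightarrow> splits ((!) \<pi>) ({..<length \<pi>} - {i})"
    unfolding img[symmetric] by (rule splits_strict_mono_image[OF e])
  finally show ?thesis .
qed

lemma delete_entry_nth:
  assumes "distinct \<pi>" "k < length \<pi>"
  shows "delete_entry (\<pi> ! k) \<pi> = delete_position k \<pi>"
proof -
  have eq: "\<pi> = take k \<pi> @ \<pi> ! k # drop (Suc k) \<pi>" by (simp add: id_take_nth_drop assms)
  have "\<pi> ! k \<notin> set (take k \<pi>)" "\<pi> ! k \<notin> set (drop (Suc k) \<pi>)"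
    using assms(1) by (subst (asm) eq, auto)+
  then have "removeAll (\<pi> ! k) \<pi> = take k \<pi> @ drop (Suc k) \<pi>"
    by (subst (2) eq) (simp add: removeAll_id)
  then show ?thesis by (simp add: delete_entry_def delete_position_def)
qed

lemma nth_inv_into_perm:
  assumes "is_perm \<pi>" "1 \<le> v" "v \<le> length \<pi>"
  shows "inv_into {..<length \<pi>} ((!) \<pi>) v < length \<pi>"
    "\<pi> ! inv_into {..<length \<pi>} ((!) \<pi>) v = v"
proof -
  have "v \<in> (!) \<pi> ` {..<length \<pi>}" using is_perm_obtain[OF assms] by blast
  from inv_into_into[OF this] f_inv_into_f[OF this]
  show "inv_into {..<length \<pi>} ((!) \<pi>) v < length \<pi>"
    "\<pi> ! inv_into {..<length \<pi>} ((!) \<pi>) v = v" by simp_all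
qed

lemma extremal_positions_less:
  assumes "is_perm \<pi>" "\<pi> \<noteq> []" "i \<in> extremal_positions \<pi>"
  shows "i < length \<pi>"
  using assms nth_inv_into_perm(1)[OF assms(1), of 1]
    nth_inv_into_perm(1)[OF assms(1), of "length \<pi>"]
  by (auto simp: extremal_positions_def Suc_le_eq)

lemma almost_decomposable_iff:
  assumes "is_perm \<pi>" "\<pi> \<noteq> []"
  shows "almost_decomposable \<pi> \<longleftrightarrow> \<not> decomposable \<pi> \<and>
    (\<exists>k \<in> extremal_positions \<pi>. decomposable (delete_position k \<pi>))"
proof -
  have len: "1 \<le> length \<pi>" using assms by (simp add: Suc_le_eq)
  note d = is_permD(1)[OF assms(1)]
  have "delete_entry 1 \<pi> = delete_position (inv_into {..<length \<pi>} ((!) \<pi>) 1) \<pi>"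
    using delete_entry_nth[OF d nth_inv_into_perm(1)[OF assms(1) order.refl len]]
      nth_inv_into_perm(2)[OF assms(1) order.refl len] by simp
  moreover have "delete_entry (length \<pi>) \<pi> =
      delete_position (inv_into {..<length \<pi>} ((!) \<pi>) (length \<pi>)) \<pi>"
    using delete_entry_nth[OF d nth_inv_into_perm(1)[OF assms(1) len order.refl]]
      nth_inv_into_perm(2)[OF assms(1) len order.refl] by simp
  moreover have "delete_entry (hd \<pi>) \<pi> = delete_position 0 \<pi>"
    using delete_entry_nth[OF d, of 0] assms by (simp add: hd_conv_nth)
  moreover have "delete_entry (last \<pi>) \<pi> = delete_position (length \<pi> - 1) \<pi>"
    using delete_entry_nth[OF d, of "length \<pi> - 1"] assms by (simp add: last_conv_nth)
  ultimately show ?thesis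
    by (auto simp: almost_decomposable_def extremal_positions_def)
qed

section \<open>Block maps\<close>

text \<open>The map \<open>p\<close> exhibits \<open>\<pi>\<close> as an inflation of \<open>\<sigma>\<close> without naming the block sizes: it
  sends each position of \<open>\<pi>\<close> to the position of \<open>\<sigma>\<close> whose block contains it. Equality in
  \<open>\<sigma> ! p k \<le> \<sigma> ! p l\<close> occurs for positions in a common block, so the last clause says
  both that blocks are increasing and that distinct blocks compare as in \<open>\<sigma>\<close>.\<close>

definition block_map :: "(nat \<Rightarrow> nat) \<Rightarrow> nat list \<Rightarrow> nat list \<Rightarrow> bool" where
  "block_map p \<sigma> \<pi> \<longleftrightarrow> p ` {..<length \<pi>} = {..<length \<sigma>} \<and> mono_on {..<length \<pi>} p \<and>
     (\<forall>k l. k < l \<and> l < length \<pi> \<longrightarrow> (\<pi> ! k < \<pi> ! l \<longleftrightarrow> \<sigma> ! p k \<le> \<sigma> ! p l))"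

lemma block_map_less_length:
  "block_map p \<sigma> \<pi> \<Longrightarrow> k < length \<pi> \<Longrightarrow> p k < length \<sigma>"
  unfolding block_map_def by blast

lemma block_map_mono:
  "block_map p \<sigma> \<pi> \<Longrightarrow> k \<le> l \<Longrightarrow> l < length \<pi> \<Longrightarrow> p k \<le> p l"
  unfolding block_map_def by (auto simp: mono_on_def)

lemma block_map_less_iff:
  "block_map p \<sigma> \<pi> \<Longrightarrow> k < l \<Longrightarrow> l < length \<pi> \<Longrightarrow> \<pi> ! k < \<pi> ! l \<longleftrightarrow> \<sigma> ! p k \<le> \<sigma> ! p l"
  unfolding block_map_def by blast

lemma block_map_obtain:
  assumes "block_map p \<sigma> \<pi>" "i < length \<sigma>"
  obtains k where "k < length \<pi>" "p k = i"
proof -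
  have "i \<in> p ` {..<length \<pi>}" using assms unfolding block_map_def by blast
  then show thesis using that by auto
qed

lemma block_map_less_imp_less:
  "block_map p \<sigma> \<pi> \<Longrightarrow> k < length \<pi> \<Longrightarrow> p k < p l \<Longrightarrow> k < l"
  using block_map_mono[of p \<sigma> \<pi> l k] by (auto simp: not_le[symmetric])

lemma block_map_le:
  assumes "block_map p \<sigma> \<pi>" "k < length \<pi>" "l < length \<pi>" "\<pi> ! k \<le> \<pi> ! l" "is_perm \<pi>"
  shows "\<sigma> ! p k \<le> \<sigma> ! p l"
proof (cases k l rule: linorder_cases)
  case less
  then show ?thesis
    using block_map_less_iff[OF assms(1) less assms(3)] is_perm_nth_eq_iff[OF assms(5,2,3)] assms(4)
    by simp
next
  case greater
  then show ?thesis using block_map_less_iff[OF assms(1) greater assms(2)] assms(4) by simp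
qed simp

lemma block_map_less:
  assumes "block_map p \<sigma> \<pi>" "k < length \<pi>" "l < length \<pi>" "\<sigma> ! p k < \<sigma> ! p l" "is_perm \<pi>"
  shows "\<pi> ! k < \<pi> ! l"
  using block_map_le[OF assms(1,3,2) _ assms(5)] assms(4) by (meson not_le)

lemma block_map_zero:
  assumes "block_map p \<sigma> \<pi>" "\<pi> \<noteq> []"
  shows "p 0 = 0"
proof -
  have "0 < length \<sigma>" using block_map_less_length[OF assms(1), of 0] assms(2) by auto
  then obtain k where "k < length \<pi>" "p k = 0" using block_map_obtain[OF assms(1)] by blast
  then show ?thesis using block_map_mono[OF assms(1), of 0 k] by auto
qed

lemma block_map_last:
  assumes "block_map p \<sigma> \<pi>" "\<pi> \<noteq> []"
  shows "p (length \<pi> - 1) = length \<sigma> - 1"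
proof -
  have "0 < length \<sigma>" using block_map_less_length[OF assms(1), of 0] assms(2) by auto
  then obtain k where "k < length \<pi>" "p k = length \<sigma> - 1"
    using block_map_obtain[OF assms(1), of "length \<sigma> - 1"] by auto
  then show ?thesis
    using block_map_mono[OF assms(1), of k "length \<pi> - 1"]
      block_map_less_length[OF assms(1), of "length \<pi> - 1"] by fastforce
qed

lemma block_map_comp:
  assumes q: "block_map q \<tau> \<pi>" and p: "block_map p \<sigma> \<tau>" and "is_perm \<tau>"
  shows "block_map (p \<circ> q) \<sigma> \<pi>"
  unfolding block_map_def
proof (intro conjI allI impI)
  show "(p \<circ> q) ` {..<length \<pi>} = {..<length \<sigma>}"
    using p q unfolding block_map_def image_comp[symmetric] by simp
  show "mono_on {..<length \<pi>} (p \<circ> q)"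
    by (auto intro!: mono_onI block_map_mono[OF p] block_map_mono[OF q]
        block_map_less_length[OF q])
  fix k l assume kl: "k < l \<and> l < length \<pi>"
  then have le: "q k \<le> q l" and l: "q l < length \<tau>"
    using block_map_mono[OF q, of k l] block_map_less_length[OF q, of l] by auto
  have "\<pi> ! k < \<pi> ! l \<longleftrightarrow> \<tau> ! q k \<le> \<tau> ! q l" using block_map_less_iff[OF q] kl by blast
  also have "\<dots> \<longleftrightarrow> \<sigma> ! p (q k) \<le> \<sigma> ! p (q l)"
  proof (cases "q k = q l")
    case False
    then show ?thesis
      using block_map_less_iff[OF p, of "q k" "q l"] le l is_perm_nth_eq_iff[OF assms(3), of "q k" "q l"]
      by (simp add: le_less)
  qed simp
  finally show "\<pi> ! k < \<pi> ! l \<longleftrightarrow> \<sigma> ! (p \<circ> q) k \<le> \<sigma> ! (p \<circ> q) l" by simp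
qed

text \<open>A cut of the inflated pattern that falls between two blocks is a cut of the base. A
  cut inside a block forces all earlier blocks below it and all later blocks above it, so
  the base can be cut right before or right after that entry; this needs a second block,
  since the inflation of a single entry may be decomposable.\<close>

lemma splits_block_iff:
  assumes mono: "mono_on A p" and img: "p ` A = B" and two: "i \<in> B" "j \<in> B" "i \<noteq> j"
    and cmp: "\<And>k l. k \<in> A \<Longrightarrow> l \<in> A \<Longrightarrow> k < l \<Longrightarrow> f k < f l \<longleftrightarrow> g (p k) \<le> g (p l)"
    and inj: "inj_on g B" and fin: "finite A"
  shows "splits f A \<longleftrightarrow> splits g B"
proof
  assume "splits g B"
  then obtain d where d: "\<exists>k\<in>B. k < d" "\<exists>k\<in>B. d \<le> k"
    "\<And>k l. k \<in> B \<Longrightarrow> l \<in> B \<Longrightarrow> k < d \<Longrightarrow> d \<le> l \<Longrightarrow> g k < g l"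
    unfolding splits_def by blast
  \<comment> \<open>Cut at the first position of the blocks from \<open>d\<close> on.\<close>
  define c where "c = (LEAST k. k \<in> A \<and> d \<le> p k)"
  have "\<exists>k. k \<in> A \<and> d \<le> p k" using d(2) img by blast
  then have "c \<in> A \<and> d \<le> p c" unfolding c_def by (rule LeastI_ex)
  then have c: "c \<in> A" "d \<le> p c" by auto
  have iff: "k < c \<longleftrightarrow> p k < d" if "k \<in> A" for k
  proof
    assume "k < c" then show "p k < d"
      using that not_less_Least[of k "\<lambda>k. k \<in> A \<and> d \<le> p k"] by (auto simp: c_def)
  next
    assume "p k < d" then show "k < c"
      using mono_onD[OF mono c(1) that] c(2) by (meson le_trans not_le)
  qed
  have "f k < f l" if "k \<in> A" "l \<in> A" "k < c" "c \<le> l" for k l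
    using cmp[of k l] d(3)[of "p k" "p l"] iff[of k] iff[of l] that img by fastforce
  moreover have "\<exists>k\<in>A. k < c" using d(1) img iff by blast
  ultimately show "splits f A" unfolding splits_def using c(1) by blast
next
  assume "splits f A"
  then obtain c where c: "\<exists>k\<in>A. k < c" "\<exists>k\<in>A. c \<le> k"
    "\<And>k l. k \<in> A \<Longrightarrow> l \<in> A \<Longrightarrow> k < c \<Longrightarrow> c \<le> l \<Longrightarrow> f k < f l"
    unfolding splits_def by blast
  have lt: "g (p k) < g (p l)"
    if "k \<in> A" "l \<in> A" "k < c" "c \<le> l" "p k \<noteq> p l" for k l
  proof -
    have "g (p k) \<le> g (p l)" using c(3) cmp that by (meson less_le_trans)
    moreover have "g (p k) \<noteq> g (p l)" using inj that img by (auto dest: inj_onD)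
    ultimately show ?thesis by simp
  qed
  show "splits g B"
  proof (cases "\<exists>k\<in>A. \<exists>l\<in>A. k < c \<and> c \<le> l \<and> p k = p l")
    case False
    \<comment> \<open>No block straddles the cut: cut the base before the first block on its right.\<close>
    define d where "d = (LEAST x. \<exists>l\<in>A. c \<le> l \<and> x = p l)"
    have "\<exists>x. \<exists>l\<in>A. c \<le> l \<and> x = p l" using c(2) by blast
    then have "\<exists>l\<in>A. c \<le> l \<and> d = p l" unfolding d_def by (rule LeastI_ex)
    then obtain l0 where l0: "l0 \<in> A" "c \<le> l0" "d = p l0" by blast
    have right: "d \<le> p l" if "l \<in> A" "c \<le> l" for l
      unfolding d_def by (rule Least_le) (use that in blast)
    have left: "p k < d" if "k \<in> A" "k < c" for k
      using False mono_onD[OF mono that(1) l0(1)] that l0 by (metis le_less less_le_trans)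
    have "g x < g y" if "x \<in> B" "y \<in> B" "x < d" "d \<le> y" for x y
    proof -
      obtain k l where kl: "k \<in> A" "x = p k" "l \<in> A" "y = p l" using \<open>x \<in> B\<close> \<open>y \<in> B\<close> img by blast
      have "k < c" using right[OF kl(1)] kl that by (meson not_le)
      moreover have "c \<le> l" using left[OF kl(3)] kl that by (meson not_le)
      ultimately show ?thesis using lt[of k l] kl that by auto
    qed
    moreover have "\<exists>x\<in>B. x < d" using c(1) left img by blast
    moreover have "\<exists>x\<in>B. d \<le> x" using l0 img by blast
    ultimately show ?thesis unfolding splits_def by blast
  next
    case True
    then obtain k0 l0 where kl: "k0 \<in> A" "l0 \<in> A" "k0 < c" "c \<le> l0" "p k0 = p l0" by blast
    define m where "m = p k0"
    have below: "g x < g m" if "x \<in> B" "x < m" for x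
    proof -
      obtain k where k: "k \<in> A" "x = p k" using \<open>x \<in> B\<close> img by blast
      then have "k < k0" using mono_onD[OF mono kl(1) k(1)] that m_def by (meson not_le)
      then show ?thesis using lt[of k l0] kl k that m_def by auto
    qed
    have above: "g m < g y" if "y \<in> B" "m < y" for y
    proof -
      obtain l where l: "l \<in> A" "y = p l" using \<open>y \<in> B\<close> img by blast
      then have "l0 < l" using mono_onD[OF mono l(1) kl(2)] that m_def kl by (metis not_le)
      then show ?thesis using lt[of k0 l] kl l that m_def by auto
    qed
    have m: "m \<in> B" using kl img m_def by blast
    have cross: "g x < g y" if "x \<in> B" "y \<in> B" "x < m" "m \<le> y" for x y
      using below[of x] above[of y] that by (cases "y = m") auto
    have cross': "g x < g y" if "x \<in> B" "y \<in> B" "x \<le> m" "m < y" for x y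
      using below[of x] above[of y] that by (cases "x = m") auto
    show ?thesis
    proof (cases "\<exists>x\<in>B. x < m")
      case True
      then show ?thesis unfolding splits_def using m cross by (intro exI[of _ m]) auto
    next
      case False
      then have "\<exists>y\<in>B. m < y" using two by (metis linorder_neqE_nat)
      then show ?thesis unfolding splits_def using m cross'
        by (intro exI[of _ "Suc m"]) (auto simp: less_Suc_eq_le Suc_le_eq)
    qed
  qed
qed

lemma block_map_decomposable_iff:
  assumes "block_map p \<sigma> \<pi>" "is_perm \<sigma>" "is_perm \<pi>" "2 \<le> length \<sigma>"
  shows "decomposable \<pi> \<longleftrightarrow> decomposable \<sigma>"
proof -
  have "splits ((!) \<pi>) {..<length \<pi>} \<longleftrightarrow> splits ((!) \<sigma>) {..<length \<sigma>}"
  proof (rule splits_block_iff[where p = p and i = 0 and j = 1])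
    show "inj_on ((!) \<sigma>) {..<length \<sigma>}"
      using is_perm_nth_eq_iff[OF assms(2)] by (auto simp: inj_on_def)
  qed (use assms in \<open>auto simp: block_map_def\<close>)
  then show ?thesis
    unfolding decomposable_iff_splits[OF assms(2)] decomposable_iff_splits[OF assms(3)] .
qed

text \<open>Deleting an entry from a block of size at least two leaves an inflation of the same
  base; deleting a block of size one leaves an inflation of the base without that entry.
  A base of length two is special because a single increasing block is left over.\<close>

lemma block_map_delete_position_iff:
  assumes bm: "block_map p \<sigma> \<pi>" and \<sigma>: "is_perm \<sigma>" and \<pi>: "is_perm \<pi>"
    and len: "2 \<le> length \<sigma>" "3 \<le> length \<pi>" and ind: "\<not> decomposable \<sigma>"
    and k: "k < length \<pi>"
  shows "decomposable (delete_position k \<pi>) \<longleftrightarrow>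
    card {l. l < length \<pi> \<and> p l = p k} < 2 \<and>
    (decomposable (delete_position (p k) \<sigma>) \<or> length \<sigma> = 2)"
proof -
  define A where "A = {..<length \<pi>} - {k}"
  have inj: "inj_on ((!) \<sigma>) B" if "B \<subseteq> {..<length \<sigma>}" for B
    using is_perm_nth_eq_iff[OF \<sigma>] that by (auto simp: inj_on_def)
  have mono: "mono_on A p" using bm by (auto simp: A_def block_map_def mono_on_def)
  have cmp: "\<pi> ! l < \<pi> ! m \<longleftrightarrow> \<sigma> ! p l \<le> \<sigma> ! p m" if "l \<in> A" "m \<in> A" "l < m" for l m
    using that block_map_less_iff[OF bm] by (auto simp: A_def)
  have dec: "decomposable (delete_position k \<pi>) \<longleftrightarrow> splits ((!) \<pi>) A"
    using decomposable_delete_position_iff[OF is_permD(1)[OF \<pi>] k] by (simp add: A_def)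
  have pk: "p k < length \<sigma>" by (rule block_map_less_length[OF bm k])
  have img: "p ` {..<length \<pi>} = {..<length \<sigma>}" using bm by (simp add: block_map_def)
  show ?thesis
  proof (cases "\<exists>l<length \<pi>. l \<noteq> k \<and> p l = p k")
    case True
    then obtain l where l: "l < length \<pi>" "l \<noteq> k" "p l = p k" by blast
    have "card {k, l} \<le> card {l. l < length \<pi> \<and> p l = p k}"
      using l k by (intro card_mono) auto
    then have "2 \<le> card {l. l < length \<pi> \<and> p l = p k}" using l by simp
    moreover have "p ` A = {..<length \<sigma>}"
    proof -
      have "p ` {..<length \<pi>} = p ` A"
      proof
        show "p ` {..<length \<pi>} \<subseteq> p ` A"
        proof
          fix x assume "x \<in> p ` {..<length \<pi>}"
          then obtain m where "m < length \<pi>" "x = p m" by auto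
          then show "x \<in> p ` A"
            using l by (intro image_eqI[of _ _ "if m = k then l else m"]) (auto simp: A_def)
        qed
      qed (auto simp: A_def)
      then show ?thesis using img by simp
    qed
    then have "splits ((!) \<pi>) A \<longleftrightarrow> splits ((!) \<sigma>) {..<length \<sigma>}"
      using len mono cmp inj[of "{..<length \<sigma>}"]
      by (intro splits_block_iff[where p = p and i = 0 and j = 1]) (auto simp: A_def)
    ultimately show ?thesis using ind dec \<sigma> by (simp add: decomposable_iff_splits)
  next
    case False
    then have "{l. l < length \<pi> \<and> p l = p k} = {k}" using k by auto
    then have card: "card {l. l < length \<pi> \<and> p l = p k} = 1" by simp
    have img': "p ` A = {..<length \<sigma>} - {p k}"
    proof
      show "p ` A \<subseteq> {..<length \<sigma>} - {p k}"
        using False block_map_less_length[OF bm] by (auto simp: A_def)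
      show "{..<length \<sigma>} - {p k} \<subseteq> p ` A"
      proof
        fix x assume x: "x \<in> {..<length \<sigma>} - {p k}"
        then obtain m where "m < length \<pi>" "p m = x" using block_map_obtain[OF bm, of x] by auto
        then show "x \<in> p ` A" using x by (auto simp: A_def)
      qed
    qed
    show ?thesis
    proof (cases "length \<sigma> = 2")
      case True
      have const: "p l = 1 - p k" if "l \<in> A" for l
      proof -
        have "p l \<in> {..<length \<sigma>} - {p k}" using img' that by blast
        then show ?thesis using True pk by auto
      qed
      have card2: "card A \<ge> 2" using len k by (simp add: A_def)
      then obtain a b where ab: "a \<in> A" "b \<in> A" "a < b"
      proof -
        obtain B where B: "B \<subseteq> A" "card B = 2" using card2 obtain_subset_with_card_n by metis
        then obtain x y where "B = {x, y}" "x \<noteq> y" by (auto simp: card_2_iff)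
        then show thesis using B that[of x y] that[of y x] by (cases "x < y") auto
      qed
      have "splits ((!) \<pi>) A"
        unfolding splits_def using ab cmp const by (intro exI[of _ b]) fastforce
      then show ?thesis using dec card True by simp
    next
      case False
      then have "2 \<le> card ({..<length \<sigma>} - {p k})" using len pk by simp
      then obtain B where B: "B \<subseteq> {..<length \<sigma>} - {p k}" "card B = 2"
        using obtain_subset_with_card_n by metis
      then obtain x y where xy: "B = {x, y}" "x \<noteq> y" by (auto simp: card_2_iff)
      have "splits ((!) \<pi>) A \<longleftrightarrow> splits ((!) \<sigma>) ({..<length \<sigma>} - {p k})"
        using B xy mono cmp inj[of "{..<length \<sigma>} - {p k}"] img'
        by (intro splits_block_iff[where p = p and i = x and j = y]) (auto simp: A_def)
      then show ?thesis
        using dec card False decomposable_delete_position_iff[OF is_permD(1)[OF \<sigma>] pk] by simp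
    qed
  qed
qed

lemma block_map_extremal_positions:
  assumes bm: "block_map p \<sigma> \<pi>" and \<sigma>: "is_perm \<sigma>" and \<pi>: "is_perm \<pi>" and "\<pi> \<noteq> []"
  shows "p ` extremal_positions \<pi> = extremal_positions \<sigma>"
proof -
  have n: "1 \<le> length \<pi>" using assms by (simp add: Suc_le_eq)
  have s: "1 \<le> length \<sigma>" using block_map_less_length[OF bm, of 0] n by linarith
  let ?inv = "\<lambda>\<tau>. inv_into {..<length \<tau>} ((!) \<tau>)"
  note inv\<pi> = nth_inv_into_perm[OF \<pi>] and inv\<sigma> = nth_inv_into_perm[OF \<sigma>]
  have "\<sigma> ! p (?inv \<pi> 1) = \<sigma> ! ?inv \<sigma> 1"
  proof -
    obtain k where k: "k < length \<pi>" "p k = ?inv \<sigma> 1"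
      using block_map_obtain[OF bm inv\<sigma>(1)] s by blast
    have "\<sigma> ! p (?inv \<pi> 1) \<le> \<sigma> ! p k"
      using inv\<pi>[of 1] n k is_perm_nth_bounds[OF \<pi> k(1)]
      by (intro block_map_le[OF bm _ k(1) _ \<pi>]) auto
    moreover have "1 \<le> \<sigma> ! p (?inv \<pi> 1)"
      using is_perm_nth_bounds(1)[OF \<sigma> block_map_less_length[OF bm inv\<pi>(1)]] n by auto
    ultimately show ?thesis using k inv\<sigma>(2)[of 1] s by auto
  qed
  then have one: "p (?inv \<pi> 1) = ?inv \<sigma> 1"
    using is_perm_nth_eq_iff[OF \<sigma> block_map_less_length[OF bm inv\<pi>(1)] inv\<sigma>(1)] n s by auto
  have "\<sigma> ! p (?inv \<pi> (length \<pi>)) = \<sigma> ! ?inv \<sigma> (length \<sigma>)"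
  proof -
    obtain k where k: "k < length \<pi>" "p k = ?inv \<sigma> (length \<sigma>)"
      using block_map_obtain[OF bm inv\<sigma>(1)] s by blast
    have "\<sigma> ! p k \<le> \<sigma> ! p (?inv \<pi> (length \<pi>))"
      using inv\<pi>[of "length \<pi>"] n k is_perm_nth_bounds[OF \<pi> k(1)]
      by (intro block_map_le[OF bm k(1) _ _ \<pi>]) auto
    moreover have "\<sigma> ! p (?inv \<pi> (length \<pi>)) \<le> length \<sigma>"
      using is_perm_nth_bounds(2)[OF \<sigma> block_map_less_length[OF bm inv\<pi>(1)]] n by auto
    ultimately show ?thesis using k inv\<sigma>(2)[of "length \<sigma>"] s by auto
  qed
  then have "p (?inv \<pi> (length \<pi>)) = ?inv \<sigma> (length \<sigma>)"
    using is_perm_nth_eq_iff[OF \<sigma> block_map_less_length[OF bm inv\<pi>(1)] inv\<sigma>(1)] n s by auto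
  then show ?thesis
    using one block_map_zero[OF bm assms(4)] block_map_last[OF bm assms(4)]
    by (simp add: extremal_positions_def)
qed

text \<open>An occurrence of 1324 in an inflation meets four different blocks: the entries 3 and 2
  form a descent, and a block containing the 1 together with another entry of the pattern
  would have to contain a descent, by consecutiveness of its positions and values;
  likewise for the 4.\<close>

lemma block_map_avoids_1324_iff:
  assumes bm: "block_map p \<sigma> \<pi>" and \<sigma>: "is_perm \<sigma>" and \<pi>: "is_perm \<pi>"
  shows "avoids_1324 \<pi> \<longleftrightarrow> avoids_1324 \<sigma>"
proof -
  have "(\<exists>i1 i2 i3 i4. i1 < i2 \<and> i2 < i3 \<and> i3 < i4 \<and> i4 < length \<sigma> \<and>
          \<sigma> ! i1 < \<sigma> ! i3 \<and> \<sigma> ! i3 < \<sigma> ! i2 \<and> \<sigma> ! i2 < \<sigma> ! i4) \<longleftrightarrow>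
        (\<exists>k1 k2 k3 k4. k1 < k2 \<and> k2 < k3 \<and> k3 < k4 \<and> k4 < length \<pi> \<and>
          \<pi> ! k1 < \<pi> ! k3 \<and> \<pi> ! k3 < \<pi> ! k2 \<and> \<pi> ! k2 < \<pi> ! k4)" (is "?L \<longleftrightarrow> ?R")
  proof
    assume ?L
    then obtain i1 i2 i3 i4 where i: "i1 < i2" "i2 < i3" "i3 < i4" "i4 < length \<sigma>"
      "\<sigma> ! i1 < \<sigma> ! i3" "\<sigma> ! i3 < \<sigma> ! i2" "\<sigma> ! i2 < \<sigma> ! i4" by blast
    obtain k1 where k1: "k1 < length \<pi>" "p k1 = i1" using block_map_obtain[OF bm, of i1] i by auto
    obtain k2 where k2: "k2 < length \<pi>" "p k2 = i2" using block_map_obtain[OF bm, of i2] i by auto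
    obtain k3 where k3: "k3 < length \<pi>" "p k3 = i3" using block_map_obtain[OF bm, of i3] i by auto
    obtain k4 where k4: "k4 < length \<pi>" "p k4 = i4" using block_map_obtain[OF bm, of i4] i by auto
    have "k1 < k2" "k2 < k3" "k3 < k4"
      using block_map_less_imp_less[OF bm] k1 k2 k3 k4 i by metis+
    moreover have "\<pi> ! k1 < \<pi> ! k3" "\<pi> ! k3 < \<pi> ! k2" "\<pi> ! k2 < \<pi> ! k4"
      using block_map_less[OF bm _ _ _ \<pi>] k1 k2 k3 k4 i by auto
    ultimately show ?R using k4 by blast
  next
    assume ?R
    then obtain k1 k2 k3 k4 where k: "k1 < k2" "k2 < k3" "k3 < k4" "k4 < length \<pi>"
      "\<pi> ! k1 < \<pi> ! k3" "\<pi> ! k3 < \<pi> ! k2" "\<pi> ! k2 < \<pi> ! k4" by blast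
    have s: "\<sigma> ! p k3 < \<sigma> ! p k2" "\<sigma> ! p k1 \<le> \<sigma> ! p k3" "\<sigma> ! p k2 \<le> \<sigma> ! p k4"
      using block_map_less_iff[OF bm, of k2 k3] block_map_less_iff[OF bm, of k1 k3]
        block_map_less_iff[OF bm, of k2 k4] k by auto
    have le: "p k1 \<le> p k2" "p k2 \<le> p k3" "p k3 \<le> p k4"
      using block_map_mono[OF bm] k by auto
    have "p k2 \<noteq> p k3" "p k1 \<noteq> p k2" "p k3 \<noteq> p k4" using s by auto
    then have lt: "p k1 < p k2" "p k2 < p k3" "p k3 < p k4" using le by auto
    have l4: "p k4 < length \<sigma>" using block_map_less_length[OF bm] k by blast
    have "\<sigma> ! p k1 \<noteq> \<sigma> ! p k3" "\<sigma> ! p k2 \<noteq> \<sigma> ! p k4"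
      using is_perm_nth_eq_iff[OF \<sigma>, of "p k1" "p k3"] is_perm_nth_eq_iff[OF \<sigma>, of "p k2" "p k4"]
        lt l4 by auto
    then show ?L using s lt l4 by (meson le_neq_implies_less)
  qed
  then show ?thesis by (simp add: avoids_1324_def)
qed

lemma block_map_inversion_number:
  assumes bm: "block_map p \<sigma> \<pi>" and \<sigma>: "is_perm \<sigma>" and \<pi>: "is_perm \<pi>"
  shows "inversion_number \<pi> = (\<Sum>(i, j) \<in> inversions \<sigma>.
    card {k. k < length \<pi> \<and> p k = i} * card {k. k < length \<pi> \<and> p k = j})"
proof -
  define F where "F i = {k. k < length \<pi> \<and> p k = i}" for i
  have eq: "inversions \<pi> = (\<Union>(i, j) \<in> inversions \<sigma>. F i \<times> F j)"
  proof (intro set_eqI iffI)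
    fix x assume "x \<in> inversions \<pi>"
    then obtain k l where x: "x = (k, l)" "k < l" "l < length \<pi>" "\<pi> ! l < \<pi> ! k"
      by (auto simp: inversions_def)
    then have lt: "\<sigma> ! p l < \<sigma> ! p k" using block_map_less_iff[OF bm, of k l] by auto
    then have "p k \<noteq> p l" by auto
    then have "p k < p l" using block_map_mono[OF bm, of k l] x by auto
    then have "(p k, p l) \<in> inversions \<sigma>"
      using lt block_map_less_length[OF bm, of l] x by (auto simp: inversions_def)
    then show "x \<in> (\<Union>(i, j) \<in> inversions \<sigma>. F i \<times> F j)"
      using x by (auto simp: F_def intro!: bexI[of _ "(p k, p l)"])
  next
    fix x assume "x \<in> (\<Union>(i, j) \<in> inversions \<sigma>. F i \<times> F j)"
    then obtain k l where x: "x = (k, l)" "k < length \<pi>" "l < length \<pi>" "p k < p l" "\<sigma> ! p l < \<sigma> ! p k"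
      by (auto simp: F_def inversions_def)
    then show "x \<in> inversions \<pi>"
      using block_map_less_imp_less[OF bm, of k l] block_map_less[OF bm, of l k] \<pi>
      by (auto simp: inversions_def)
  qed
  have "inversions \<sigma> \<subseteq> {..<length \<sigma>} \<times> {..<length \<sigma>}" by (auto simp: inversions_def)
  then have fin: "finite (inversions \<sigma>)" by (rule finite_subset) auto
  have "card (inversions \<pi>) = (\<Sum>x \<in> inversions \<sigma>. card (case x of (i, j) \<Rightarrow> F i \<times> F j))"
    unfolding eq by (rule card_UN_disjoint[OF fin]) (auto simp: F_def)
  then show ?thesis
    unfolding inversion_number_def
    by (simp add: F_def card_cartesian_product case_prod_beta' split_def)
qed

section \<open>The block map of an inflation\<close>

lemma nth_concat_map_upt:
  assumes "i < s" "r < length (f i)"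
  shows "concat (map f [0..<s]) ! ((\<Sum>j<i. length (f j)) + r) = f i ! r"
  using assms
proof (induction s)
  case (Suc s)
  have len: "length (concat (map f [0..<s])) = (\<Sum>j<s. length (f j))" for s
    by (induction s) auto
  show ?case
  proof (cases "i = s")
    case True
    then show ?thesis using Suc.prems by (simp add: nth_append len)
  next
    case False
    then have i: "i < s" using Suc.prems by simp
    have "(\<Sum>j<i. length (f j)) + r < (\<Sum>j<Suc i. length (f j))" using Suc.prems by simp
    also have "\<dots> \<le> (\<Sum>j<s. length (f j))" using i by (intro sum_mono2) auto
    finally show ?thesis using Suc i by (simp add: nth_append len)
  qed
qed simp

text \<open>The block at position \<open>i\<close> occupies the positions that follow the total size of the
  blocks at earlier positions.\<close>

lemma inflation_block_map:
  assumes \<sigma>: "is_perm \<sigma>" and b: "b \<in> block_sizes \<sigma> n"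
  obtains p where "block_map p \<sigma> (inflation \<sigma> b)" "length (inflation \<sigma> b) = n"
    "is_perm (inflation \<sigma> b)"
    "\<And>i. i < length \<sigma> \<Longrightarrow> {k. k < n \<and> p k = i} = {(\<Sum>j<i. b ! j)..<(\<Sum>j<Suc i. b ! j)}"
proof -
  define s where "s = length \<sigma>"
  define S where "S i = (\<Sum>j<i. b ! j)" for i
  define p where "p k = (LEAST i. k < S (Suc i))" for k
  define \<pi> where "\<pi> = inflation \<sigma> b"
  have lb: "length b = s" and pos: "\<And>i. i < s \<Longrightarrow> 1 \<le> b ! i" and n: "sum_list b = n"
    using b by (auto simp: block_sizes_def s_def)
  have Ss: "S s = n" using n lb by (simp add: S_def sum_list_sum_nth lessThan_atLeast0)
  have S0: "S 0 = 0" and SSuc: "S (Suc i) = S i + b ! i" for i by (auto simp: S_def)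
  have Smono: "S i \<le> S j" if "i \<le> j" for i j using that by (auto simp: S_def intro: sum_mono2)
  have p: "p k < s \<and> S (p k) \<le> k \<and> k < S (Suc (p k))" if "k < n" for k
  proof -
    have s0: "s \<noteq> 0" using that Ss S0 by (cases s) auto
    then have ex: "k < S (Suc (s - 1))" using that Ss by simp
    have "p k \<le> s - 1" unfolding p_def by (rule Least_le) (rule ex)
    moreover have "k < S (Suc (p k))" unfolding p_def by (rule LeastI[of _ "s - 1"]) (rule ex)
    moreover have "S (p k) \<le> k"
    proof (cases "p k")
      case (Suc m)
      then have "\<not> k < S (Suc m)" using not_less_Least[of m "\<lambda>i. k < S (Suc i)"] by (simp add: p_def)
      then show ?thesis using Suc by simp
    qed (simp add: S0)
    ultimately show ?thesis using s0 by auto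
  qed
  have puniq: "p k = i" if "S i \<le> k" "k < S (Suc i)" for i k
    unfolding p_def
  proof (rule Least_equality)
    show "k < S (Suc i)" by (rule that(2))
    fix m assume "k < S (Suc m)"
    then show "i \<le> m" using that(1) Smono[of "Suc m" i] by (meson le_trans not_less not_less_eq_eq)
  qed
  have fibre: "{k. k < n \<and> p k = i} = {S i..<S (Suc i)}" if "i < s" for i
    using p puniq Smono[of "Suc i" s] that Ss by (auto dest: p)
  have len: "length \<pi> = n"
  proof -
    have "length (concat (map f [0..<m])) = (\<Sum>j<m. length (f j))" for f :: "nat \<Rightarrow> nat list" and m
      by (induction m) auto
    then have "length \<pi> = (\<Sum>j<s. length
        [block_offset \<sigma> b j + 1 ..< block_offset \<sigma> b j + b ! j + 1])"
      by (simp only: \<pi>_def inflation_def s_def)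
    then show ?thesis using Ss by (simp add: S_def del: upt_Suc)
  qed
  have nth: "\<pi> ! k = block_offset \<sigma> b (p k) + 1 + (k - S (p k))" if "k < n" for k
  proof -
    let ?f = "\<lambda>i. [block_offset \<sigma> b i + 1 ..< block_offset \<sigma> b i + b ! i + 1]"
    have r: "k - S (p k) < b ! p k" using p[OF that] SSuc by (simp add: less_diff_conv2)
    have "k = S (p k) + (k - S (p k))" using p[OF that] by simp
    then have "\<pi> ! k = concat (map ?f [0..<s]) ! ((\<Sum>j<p k. length (?f j)) + (k - S (p k)))"
      by (simp add: \<pi>_def inflation_def s_def S_def del: upt_Suc)
    also have "\<dots> = ?f (p k) ! (k - S (p k))"
      using p[OF that] r by (intro nth_concat_map_upt) auto
    finally show ?thesis using r by (simp add: nth_upt del: upt_Suc)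
  qed
  have off: "block_offset \<sigma> b i + b ! i \<le> block_offset \<sigma> b j"
    if "i < s" "\<sigma> ! i < \<sigma> ! j" for i j
  proof -
    have "block_offset \<sigma> b i + b ! i = (\<Sum>m \<in> insert i {m. m < length \<sigma> \<and> \<sigma> ! m < \<sigma> ! i}. b ! m)"
      by (simp add: block_offset_def)
    also have "\<dots> \<le> block_offset \<sigma> b j"
      unfolding block_offset_def using that by (intro sum_mono2) (auto simp: s_def)
    finally show ?thesis .
  qed
  have offn: "block_offset \<sigma> b i + b ! i \<le> n" if "i < s" for i
  proof -
    have "block_offset \<sigma> b i + b ! i = (\<Sum>m \<in> insert i {m. m < length \<sigma> \<and> \<sigma> ! m < \<sigma> ! i}. b ! m)"
      by (simp add: block_offset_def)
    also have "\<dots> \<le> S s"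
      unfolding S_def using that by (intro sum_mono2) (auto simp: s_def)
    finally show ?thesis using Ss by simp
  qed
  have r: "k - S (p k) < b ! p k" if "k < n" for k
    using p[OF that] SSuc by (simp add: less_diff_conv2)
  have lt: "\<pi> ! k < \<pi> ! l" if "k < n" "l < n" "\<sigma> ! p k < \<sigma> ! p l" for k l
    using nth[OF that(1)] nth[OF that(2)] r[OF that(1)] off[OF _ that(3)] p[OF that(1)] by linarith
  have pmono: "p k \<le> p l" if "k \<le> l" "l < n" for k l
  proof (rule ccontr)
    assume "\<not> p k \<le> p l"
    then have "S (Suc (p l)) \<le> S (p k)" by (intro Smono) simp
    then show False using p[of k] p[of l] that by auto
  qed
  have iff: "\<pi> ! k < \<pi> ! l \<longleftrightarrow> \<sigma> ! p k \<le> \<sigma> ! p l" if "k < l" "l < n" for k l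
  proof (cases "p k = p l")
    case True
    then show ?thesis using nth[of k] nth[of l] that p[of k] p[of l] by auto
  next
    case False
    then have "\<sigma> ! p k \<noteq> \<sigma> ! p l"
      using is_perm_nth_eq_iff[OF \<sigma>, of "p k" "p l"] p[of k] p[of l] that by (auto simp: s_def)
    then show ?thesis using lt[of k l] lt[of l k] that by fastforce
  qed
  have bm: "block_map p \<sigma> \<pi>"
    unfolding block_map_def len
  proof (intro conjI allI impI)
    show "p ` {..<n} = {..<length \<sigma>}"
    proof
      show "p ` {..<n} \<subseteq> {..<length \<sigma>}" using p by (auto simp: s_def)
      show "{..<length \<sigma>} \<subseteq> p ` {..<n}"
      proof
        fix i assume "i \<in> {..<length \<sigma>}"
        then have i: "i < s" by (simp add: s_def)
        then have "S i \<in> {k. k < n \<and> p k = i}" using fibre[OF i] pos[OF i] SSuc[of i] by auto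
        then show "i \<in> p ` {..<n}" by (intro image_eqI[of _ _ "S i"]) auto
      qed
    qed
    show "mono_on {..<n} p" using pmono by (auto intro!: mono_onI)
  qed (use iff in blast)
  have ne: "\<pi> ! k \<noteq> \<pi> ! l" if "k < l" "l < n" for k l
  proof (cases "p k = p l")
    case True
    then show ?thesis using iff[OF that] by simp
  next
    case False
    then have "\<sigma> ! p k \<noteq> \<sigma> ! p l"
      using is_perm_nth_eq_iff[OF \<sigma>, of "p k" "p l"] p[of k] p[of l] that by (auto simp: s_def)
    then show ?thesis using lt[of k l] lt[of l k] that by fastforce
  qed
  have "is_perm \<pi>"
  proof (rule is_permI)
    show d: "distinct \<pi>"
      unfolding distinct_conv_nth len using ne by (metis linorder_neqE_nat)
    have "set \<pi> \<subseteq> {1..n}"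
    proof
      fix v assume "v \<in> set \<pi>"
      then obtain k where k: "k < n" "v = \<pi> ! k" by (auto simp: in_set_conv_nth len)
      then show "v \<in> {1..n}" using nth[OF k(1)] r[OF k(1)] offn[of "p k"] p[OF k(1)] by auto
    qed
    moreover have "card (set \<pi>) = n" using distinct_card[OF d] len by simp
    ultimately show "set \<pi> = {1..length \<pi>}" using len by (simp add: card_subset_eq)
  qed
  then show thesis
    using bm len fibre by (intro that[of p]) (simp_all add: \<pi>_def s_def S_def)
qed

lemma inflation_is_perm:
  assumes "is_perm \<sigma>" "b \<in> block_sizes \<sigma> n"
  shows "is_perm (inflation \<sigma> b)" "length (inflation \<sigma> b) = n"
  by (rule inflation_block_map[OF assms], assumption)+

text \<open>Every block map is that of an inflation: a monotone map onto \<open>{..<s}\<close> is determined by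
  its fibre sizes, and a permutation by the comparisons of its entries.\<close>

lemma block_map_imp_inflation:
  assumes bm: "block_map p \<sigma> \<pi>" and \<sigma>: "is_perm \<sigma>" and \<pi>: "is_perm \<pi>"
  defines "b \<equiv> map (\<lambda>i. card {k. k < length \<pi> \<and> p k = i}) [0..<length \<sigma>]"
  shows "b \<in> block_sizes \<sigma> (length \<pi>)" "inflation \<sigma> b = \<pi>"
proof -
  define n where "n = length \<pi>"
  define F where "F i = {k. k < n \<and> p k = i}" for i
  have bi: "b ! i = card (F i)" if "i < length \<sigma>" for i
    using that by (simp add: b_def F_def n_def)
  have down: "(\<Sum>j<i. b ! j) = card {k. k < n \<and> p k < i}" if "i \<le> length \<sigma>" for i
  proof -
    have "(\<Sum>j<i. b ! j) = (\<Sum>j<i. card (F j))" using bi that by (intro sum.cong) auto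
    also have "\<dots> = card (\<Union>j\<in>{..<i}. F j)"
      by (rule card_UN_disjoint[symmetric]) (auto simp: F_def)
    also have "(\<Union>j\<in>{..<i}. F j) = {k. k < n \<and> p k < i}" by (auto simp: F_def)
    finally show ?thesis .
  qed
  show b: "b \<in> block_sizes \<sigma> (length \<pi>)"
  proof -
    have "1 \<le> b ! i" if i: "i < length \<sigma>" for i
    proof -
      obtain k where "k < length \<pi>" "p k = i" using block_map_obtain[OF bm i] by blast
      then have "F i \<noteq> {}" "finite (F i)" by (auto simp: F_def n_def)
      then show ?thesis using bi[OF i] by (simp add: Suc_le_eq card_gt_0_iff)
    qed
    moreover have "sum_list b = length \<pi>"
    proof -
      have "sum_list b = (\<Sum>j<length \<sigma>. b ! j)"
        by (simp add: sum_list_sum_nth lessThan_atLeast0 b_def)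
      also have "\<dots> = card {k. k < n \<and> p k < length \<sigma>}" using down by simp
      also have "{k. k < n \<and> p k < length \<sigma>} = {..<n}"
        using block_map_less_length[OF bm] by (auto simp: n_def)
      finally show ?thesis by (simp add: n_def)
    qed
    ultimately show ?thesis by (auto simp: block_sizes_def b_def)
  qed
  obtain q where q: "block_map q \<sigma> (inflation \<sigma> b)" "length (inflation \<sigma> b) = n"
    "is_perm (inflation \<sigma> b)"
    "\<And>i. i < length \<sigma> \<Longrightarrow> {k. k < n \<and> q k = i} = {(\<Sum>j<i. b ! j)..<(\<Sum>j<Suc i. b ! j)}"
    by (rule inflation_block_map[OF \<sigma> b, folded n_def]) blast
  have eq: "q k = p k" if k: "k < n" for k
  proof -
    have i: "p k < length \<sigma>" using block_map_less_length[OF bm] k n_def by simp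
    have "{m. m < n \<and> p m < p k} \<subseteq> {..<k}"
      using block_map_less_imp_less[OF bm] by (auto simp: n_def)
    then have "card {m. m < n \<and> p m < p k} \<le> k" using card_mono[of "{..<k}"] by fastforce
    moreover have "{..k} \<subseteq> {m. m < n \<and> p m < Suc (p k)}"
      using block_map_mono[OF bm] k by (auto simp: n_def less_Suc_eq_le)
    then have "Suc k \<le> card {m. m < n \<and> p m < Suc (p k)}"
      using card_mono[of "{m. m < n \<and> p m < Suc (p k)}" "{..k}"] by simp
    ultimately have "k \<in> {m. m < n \<and> q m = p k}"
      unfolding q(4)[OF i] using down[of "p k"] down[of "Suc (p k)"] i by simp
    then show ?thesis by simp
  qed
  show "inflation \<sigma> b = \<pi>"
  proof (rule is_perm_eqI[OF q(3) \<pi>])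
    fix k l assume "k < l" "l < length (inflation \<sigma> b)"
    then show "inflation \<sigma> b ! k < inflation \<sigma> b ! l \<longleftrightarrow> \<pi> ! k < \<pi> ! l"
      using block_map_less_iff[OF bm, of k l] block_map_less_iff[OF q(1), of k l] eq q(2) n_def
      by auto
  qed (simp add: q(2) n_def)
qed

section \<open>Existence and uniqueness of the reduced base\<close>

text \<open>Two adjacent entries with consecutive values compare alike with every other entry, so
  they can be contracted to one.\<close>

lemma block_map_contract:
  assumes \<pi>: "is_perm \<pi>" and i: "Suc i < length \<pi>" "\<pi> ! Suc i = \<pi> ! i + 1"
  shows "block_map (\<lambda>k. if k \<le> i then k else k - 1) (delete_position (Suc i) \<pi>) \<pi>"
proof -
  define q where "q k = (if k \<le> i then k else k - 1)" for k
  define e where "e m = (if m < Suc i then m else Suc m)" for m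
  define \<tau> where "\<tau> = delete_position (Suc i) \<pi>"
  have len: "length \<tau> = length \<pi> - 1" using i by (simp add: \<tau>_def length_delete_position)
  \<comment> \<open>In \<open>\<pi>\<close> the contracted pair is represented by its first entry.\<close>
  have eq: "e (q k) = (if k = Suc i then i else k)" for k by (auto simp: e_def q_def)
  have "q ` {..<length \<pi>} = {..<length \<tau>}"
  proof
    show "q ` {..<length \<pi>} \<subseteq> {..<length \<tau>}" using i by (auto simp: q_def len)
    show "{..<length \<tau>} \<subseteq> q ` {..<length \<pi>}"
    proof
      fix m assume "m \<in> {..<length \<tau>}"
      then show "m \<in> q ` {..<length \<pi>}"
        by (intro image_eqI[of _ _ "e m"]) (auto simp: e_def q_def len)
    qed
  qed
  moreover have "mono_on {..<length \<pi>} q" by (auto simp: mono_on_def q_def)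
  moreover have "\<pi> ! k < \<pi> ! l \<longleftrightarrow> \<tau> ! q k \<le> \<tau> ! q l" if kl: "k < l" "l < length \<pi>" for k l
  proof -
    have ql: "q k < length \<pi> - 1" "q l < length \<pi> - 1" using kl i by (auto simp: q_def)
    have "\<tau> ! q l < \<tau> ! q k \<longleftrightarrow> \<pi> ! e (q l) < \<pi> ! e (q k)"
      unfolding \<tau>_def using delete_position_nth_less_iff[OF i(1) ql(2,1)] by (simp add: e_def)
    also have "\<dots> \<longleftrightarrow> \<not> \<pi> ! k < \<pi> ! l"
      using is_perm_nth_eq_iff[OF \<pi>, of k l] is_perm_nth_eq_iff[OF \<pi>, of k i]
        is_perm_nth_eq_iff[OF \<pi>, of l i] is_perm_nth_eq_iff[OF \<pi>, of l "Suc i"]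
        is_perm_nth_eq_iff[OF \<pi>, of k "Suc i"] kl i
      by (auto simp: eq)
    finally show ?thesis by auto
  qed
  ultimately show ?thesis unfolding block_map_def q_def[abs_def] \<tau>_def by blast
qed

lemma reduced_base_exists:
  assumes "is_perm \<pi>"
  shows "\<exists>\<sigma> p. is_perm \<sigma> \<and> reduced \<sigma> \<and> block_map p \<sigma> \<pi>"
  using assms
proof (induction "length \<pi>" arbitrary: \<pi> rule: less_induct)
  case less
  show ?case
  proof (cases "reduced \<pi>")
    case True
    have "block_map id \<pi> \<pi>"
      using is_perm_nth_eq_iff[OF less.prems] by (auto simp: block_map_def mono_on_def le_less)
    then show ?thesis using True less.prems by blast
  next
    case False
    then obtain i where i: "Suc i < length \<pi>" "\<pi> ! Suc i = \<pi> ! i + 1" by (auto simp: reduced_def)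
    let ?\<tau> = "delete_position (Suc i) \<pi>"
    have \<tau>: "is_perm ?\<tau>" by (rule is_perm_delete_position[OF is_permD(1)[OF less.prems]])
    have "length ?\<tau> < length \<pi>" using i by (simp add: length_delete_position)
    then obtain \<sigma> p where "is_perm \<sigma>" "reduced \<sigma>" "block_map p \<sigma> ?\<tau>"
      using less.hyps \<tau> by blast
    then show ?thesis using block_map_comp[OF block_map_contract[OF less.prems i] _ \<tau>] by blast
  qed
qed

text \<open>Over a reduced base the blocks are exactly the maximal runs of consecutive values, so
  they can be read off from the inflated permutation.\<close>

lemma block_map_Suc_eq_iff:
  assumes bm: "block_map p \<sigma> \<pi>" and \<sigma>: "is_perm \<sigma>" "reduced \<sigma>" and \<pi>: "is_perm \<pi>"
    and k: "Suc k < length \<pi>"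
  shows "p (Suc k) = p k \<longleftrightarrow> \<pi> ! Suc k = \<pi> ! k + 1"
proof
  assume eq: "p (Suc k) = p k"
  then have lt: "\<pi> ! k < \<pi> ! Suc k" using block_map_less_iff[OF bm, of k "Suc k"] k by simp
  \<comment> \<open>An entry strictly between two entries of a block would compare differently with them.\<close>
  show "\<pi> ! Suc k = \<pi> ! k + 1"
  proof (rule ccontr)
    assume "\<pi> ! Suc k \<noteq> \<pi> ! k + 1"
    then have "1 \<le> \<pi> ! k + 1" "\<pi> ! k + 1 \<le> length \<pi>"
      using lt is_perm_nth_bounds[OF \<pi> k] by auto
    then obtain m where m: "m < length \<pi>" "\<pi> ! m = \<pi> ! k + 1" using is_perm_obtain[OF \<pi>] by blast
    then have bet: "\<pi> ! k < \<pi> ! m" "\<pi> ! m < \<pi> ! Suc k" "m \<noteq> k" "m \<noteq> Suc k"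
      using lt \<open>\<pi> ! Suc k \<noteq> \<pi> ! k + 1\<close> by auto
    show False
    proof (cases "m < k")
      case True
      then show ?thesis
        using block_map_less_iff[OF bm, of m k] block_map_less_iff[OF bm, of m "Suc k"] bet k eq by auto
    next
      case False
      then have "Suc k < m" using bet by auto
      then show ?thesis
        using block_map_less_iff[OF bm, of k m] block_map_less_iff[OF bm, of "Suc k" m] bet m eq by auto
    qed
  qed
next
  assume succ: "\<pi> ! Suc k = \<pi> ! k + 1"
  show "p (Suc k) = p k"
  proof (rule ccontr)
    assume ne: "p (Suc k) \<noteq> p k"
    then have lt: "p k < p (Suc k)" using block_map_mono[OF bm, of k "Suc k"] k by auto
    note pk = block_map_less_length[OF bm k]
    \<comment> \<open>The entries are in adjacent blocks; as \<open>\<sigma>\<close> is reduced, some block lies between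
      these two in value, and so does an entry of \<open>\<pi>\<close>.\<close>
    have pS: "p (Suc k) = Suc (p k)"
    proof (rule ccontr)
      assume "p (Suc k) \<noteq> Suc (p k)"
      then have "Suc (p k) < length \<sigma>" using lt pk by auto
      then obtain m where m: "m < length \<pi>" "p m = Suc (p k)" using block_map_obtain[OF bm] by blast
      have "k < m" using block_map_less_imp_less[OF bm, of k m] m k by auto
      moreover have "m < Suc k"
        using block_map_less_imp_less[OF bm, of m "Suc k"] m lt \<open>p (Suc k) \<noteq> Suc (p k)\<close> by auto
      ultimately show False by auto
    qed
    have "\<sigma> ! p k \<le> \<sigma> ! p (Suc k)" using block_map_less_iff[OF bm, of k "Suc k"] k succ by auto
    then have s: "\<sigma> ! p k < \<sigma> ! p (Suc k)" "\<sigma> ! p (Suc k) \<noteq> \<sigma> ! p k + 1"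
      using is_perm_nth_eq_iff[OF \<sigma>(1), of "p k" "p (Suc k)"] ne lt pk \<sigma>(2) pS
      by (auto simp: reduced_def le_less)
    then have "1 \<le> \<sigma> ! p k + 1" "\<sigma> ! p k + 1 \<le> length \<sigma>"
      using is_perm_nth_bounds[OF \<sigma>(1) pk] by auto
    then obtain j where j: "j < length \<sigma>" "\<sigma> ! j = \<sigma> ! p k + 1" using is_perm_obtain[OF \<sigma>(1)] by blast
    obtain m where m: "m < length \<pi>" "p m = j" using block_map_obtain[OF bm j(1)] by blast
    have "\<pi> ! k < \<pi> ! m" using block_map_less[OF bm _ m(1) _ \<pi>, of k] m j k by simp
    moreover have "\<pi> ! m < \<pi> ! Suc k" using block_map_less[OF bm m(1) k _ \<pi>] m j s by simp
    ultimately show False using succ by simp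
  qed
qed

lemma reduced_base_unique:
  assumes p: "block_map p \<sigma> \<pi>" "is_perm \<sigma>" "reduced \<sigma>"
    and q: "block_map q \<tau> \<pi>" "is_perm \<tau>" "reduced \<tau>"
    and \<pi>: "is_perm \<pi>" "\<pi> \<noteq> []"
  shows "\<sigma> = \<tau>"
proof -
  have step: "p' (Suc k) = (if \<pi> ! Suc k = \<pi> ! k + 1 then p' k else Suc (p' k))"
    if bm: "block_map p' \<rho> \<pi>" "is_perm \<rho>" "reduced \<rho>" and k: "Suc k < length \<pi>" for p' \<rho> k
  proof -
    have "p' (Suc k) \<le> Suc (p' k)"
    proof (rule ccontr)
      assume *: "\<not> p' (Suc k) \<le> Suc (p' k)"
      then have "Suc (p' k) < length \<rho>" using block_map_less_length[OF bm(1) k] by auto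
      then obtain m where m: "m < length \<pi>" "p' m = Suc (p' k)"
        using block_map_obtain[OF bm(1)] by blast
      have "k < m" using block_map_less_imp_less[OF bm(1), of k m] m k by auto
      moreover have "m < Suc k" using block_map_less_imp_less[OF bm(1), of m "Suc k"] m * by auto
      ultimately show False by auto
    qed
    then show ?thesis
      using block_map_Suc_eq_iff[OF bm \<pi>(1) k] block_map_mono[OF bm(1), of k "Suc k"] k by auto
  qed
  have eq: "p k = q k" if "k < length \<pi>" for k
    using that
  proof (induction k)
    case 0
    then show ?case using block_map_zero[OF p(1) \<pi>(2)] block_map_zero[OF q(1) \<pi>(2)] by simp
  next
    case (Suc k)
    then show ?case using step[OF p Suc.prems] step[OF q Suc.prems] by simp
  qed
  have "{..<length \<sigma>} = {..<length \<tau>}"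
    using p(1) q(1) eq unfolding block_map_def by (metis (no_types, lifting) image_cong lessThan_iff)
  then have len: "length \<sigma> = length \<tau>" by simp
  show ?thesis
  proof (rule is_perm_eqI[OF p(2) q(2) len])
    fix i j assume ij: "i < j" "j < length \<sigma>"
    obtain k where k: "k < length \<pi>" "p k = i" using block_map_obtain[OF p(1), of i] ij by auto
    obtain l where l: "l < length \<pi>" "p l = j" using block_map_obtain[OF p(1), of j] ij by auto
    have kl: "k < l" using block_map_less_imp_less[OF p(1), of k l] k l ij by auto
    have "\<sigma> ! i \<le> \<sigma> ! j \<longleftrightarrow> \<tau> ! i \<le> \<tau> ! j"
      using block_map_less_iff[OF p(1) kl l(1)] block_map_less_iff[OF q(1) kl l(1)] eq k l by auto
    then show "\<sigma> ! i < \<sigma> ! j \<longleftrightarrow> \<tau> ! i < \<tau> ! j"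
      using is_perm_nth_eq_iff[OF p(2), of i j] is_perm_nth_eq_iff[OF q(2), of i j] ij len
      by (auto simp: le_less)
  qed
qed

section \<open>Residuals\<close>

lemma inflation_mem_residuals_iff:
  assumes "3 \<le> n" and \<sigma>: "\<sigma> \<in> reduced_bases" and b: "b \<in> block_sizes \<sigma> n"
  shows "inflation \<sigma> b \<in> residuals \<delta> n \<longleftrightarrow>
    int (\<Sum>(i, j) \<in> inversions \<sigma>. b ! i * b ! j) = 2 * int n - 7 + \<delta> \<and>
    (\<forall>i \<in> critical_positions \<sigma>. 2 \<le> b ! i)"
proof -
  define \<pi> where "\<pi> = inflation \<sigma> b"
  have s: "is_perm \<sigma>" "2 \<le> length \<sigma>" "\<not> decomposable \<sigma>" "avoids_1324 \<sigma>"
    using \<sigma> by (auto simp: reduced_bases_def)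
  obtain p where p: "block_map p \<sigma> \<pi>" "length \<pi> = n" "is_perm \<pi>"
    "\<And>i. i < length \<sigma> \<Longrightarrow> {k. k < n \<and> p k = i} = {(\<Sum>j<i. b ! j)..<(\<Sum>j<Suc i. b ! j)}"
    by (rule inflation_block_map[OF s(1) b, folded \<pi>_def]) blast
  have card: "card {k. k < length \<pi> \<and> p k = i} = b ! i" if "i < length \<sigma>" for i
    using p(4)[OF that] p(2) by simp
  have ne: "\<pi> \<noteq> []" "\<sigma> \<noteq> []" using assms(1) p(2) s(2) by auto
  have inv: "inversion_number \<pi> = (\<Sum>(i, j) \<in> inversions \<sigma>. b ! i * b ! j)"
    unfolding block_map_inversion_number[OF p(1) s(1) p(3)]
    by (rule sum.cong) (auto simp: inversions_def card)
  have "\<not> decomposable \<pi>"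
    using block_map_decomposable_iff[OF p(1) s(1) p(3) s(2)] s(3) by simp
  moreover have "avoids_1324 \<pi>"
    using block_map_avoids_1324_iff[OF p(1) s(1) p(3)] s(4) by simp
  moreover have "\<not> almost_decomposable \<pi> \<longleftrightarrow> (\<forall>i \<in> critical_positions \<sigma>. 2 \<le> b ! i)"
  proof -
    have del: "decomposable (delete_position k \<pi>) \<longleftrightarrow>
        b ! p k < 2 \<and> (decomposable (delete_position (p k) \<sigma>) \<or> length \<sigma> = 2)"
      if "k \<in> extremal_positions \<pi>" for k
    proof -
      have k: "k < length \<pi>" using extremal_positions_less[OF p(3) ne(1) that] .
      show ?thesis
        using block_map_delete_position_iff[OF p(1) s(1) p(3) s(2) _ s(3) k]
          card[OF block_map_less_length[OF p(1) k]] p(2) assms(1) by simp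
    qed
    have "\<not> almost_decomposable \<pi> \<longleftrightarrow> (\<forall>k \<in> extremal_positions \<pi>.
        \<not> (b ! p k < 2 \<and> (decomposable (delete_position (p k) \<sigma>) \<or> length \<sigma> = 2)))"
      using almost_decomposable_iff[OF p(3) ne(1)] \<open>\<not> decomposable \<pi>\<close> del by blast
    also have "\<dots> \<longleftrightarrow> (\<forall>i \<in> p ` extremal_positions \<pi>.
        \<not> (b ! i < 2 \<and> (decomposable (delete_position i \<sigma>) \<or> length \<sigma> = 2)))"
      by blast
    also have "\<dots> \<longleftrightarrow> (\<forall>i \<in> critical_positions \<sigma>. 2 \<le> b ! i)"
      unfolding block_map_extremal_positions[OF p(1) s(1) p(3) ne(1)]
      by (auto simp: critical_positions_def not_le[symmetric])
    finally show ?thesis .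
  qed
  ultimately show ?thesis
    using p(2,3) inv by (auto simp: residuals_def Av_1324_def \<pi>_def[symmetric])
qed

lemma residual_is_inflation:
  assumes "3 \<le> n" "\<pi> \<in> residuals \<delta> n"
  obtains \<sigma> b where "\<sigma> \<in> reduced_bases" "b \<in> block_sizes \<sigma> n" "\<pi> = inflation \<sigma> b"
proof -
  have len: "length \<pi> = n" and \<pi>: "is_perm \<pi>" and av: "avoids_1324 \<pi>" and ind: "\<not> decomposable \<pi>"
    using assms(2) length_finite_permutations_of_set[of \<pi> "{1..n}"]
    by (auto simp: residuals_def Av_1324_def)
  obtain \<sigma> p where \<sigma>: "is_perm \<sigma>" "reduced \<sigma>" "block_map p \<sigma> \<pi>"
    using reduced_base_exists[OF \<pi>] by blast
  have s: "2 \<le> length \<sigma>"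
  proof (rule ccontr)
    assume "\<not> 2 \<le> length \<sigma>"
    \<comment> \<open>With a single block the permutation would be increasing.\<close>
    then have "p k = 0" if "k < length \<pi>" for k
      using block_map_less_length[OF \<sigma>(3) that] by auto
    then have "\<pi> ! k < \<pi> ! l" if "k < l" "l < length \<pi>" for k l
      using block_map_less_iff[OF \<sigma>(3) that] that by auto
    then have "splits ((!) \<pi>) {..<length \<pi>}"
      unfolding splits_def using assms(1) len by (intro exI[of _ 1]) force
    then show False using ind decomposable_iff_splits[OF \<pi>] by blast
  qed
  have "\<sigma> \<in> reduced_bases"
    using \<sigma> s av ind block_map_decomposable_iff[OF \<sigma>(3,1) \<pi> s]
      block_map_avoids_1324_iff[OF \<sigma>(3,1) \<pi>] by (simp add: reduced_bases_def)
  then show thesis using that block_map_imp_inflation[OF \<sigma>(3,1) \<pi>] len by metis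
qed

lemma inflation_eq_imp_base_eq:
  assumes "\<sigma> \<in> reduced_bases" "b \<in> block_sizes \<sigma> n"
    and "\<tau> \<in> reduced_bases" "c \<in> block_sizes \<tau> n"
    and "0 < n" "inflation \<sigma> b = inflation \<tau> c"
  shows "\<sigma> = \<tau>"
proof -
  have s: "is_perm \<sigma>" "reduced \<sigma>" and t: "is_perm \<tau>" "reduced \<tau>"
    using assms by (auto simp: reduced_bases_def)
  obtain p where p: "block_map p \<sigma> (inflation \<sigma> b)"
    by (rule inflation_block_map[OF s(1) assms(2)])
  obtain q where q: "block_map q \<tau> (inflation \<sigma> b)"
    by (rule inflation_block_map[OF t(1) assms(4), folded assms(6)])
  have "is_perm (inflation \<sigma> b)" "inflation \<sigma> b \<noteq> []"
    using inflation_is_perm[OF s(1) assms(2)] assms(5) by auto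
  then show ?thesis using reduced_base_unique[OF p s q t] by blast
qed

theorem theorem5p3:
  fixes n :: nat and \<delta> :: int
  assumes "3 \<le> n"
  shows "(\<forall>\<sigma> \<in> reduced_bases. \<forall>b \<in> block_sizes \<sigma> n.
            inflation \<sigma> b \<in> residuals \<delta> n \<longleftrightarrow>
              int (\<Sum>(i, j) \<in> inversions \<sigma>. b ! i * b ! j) = 2 * int n - 7 + \<delta> \<and>
              (\<forall>i \<in> critical_positions \<sigma>. 2 \<le> b ! i)) \<and>
         residuals \<delta> n = (\<Union>\<sigma> \<in> reduced_bases. residual_inflations \<delta> n \<sigma>) \<and>
         disjoint_family_on (residual_inflations \<delta> n) reduced_bases"
proof (intro conjI)
  note iff = inflation_mem_residuals_iff[OF assms]
  show "\<forall>\<sigma> \<in> reduced_bases. \<forall>b \<in> block_sizes \<sigma> n.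
            inflation \<sigma> b \<in> residuals \<delta> n \<longleftrightarrow>
              int (\<Sum>(i, j) \<in> inversions \<sigma>. b ! i * b ! j) = 2 * int n - 7 + \<delta> \<and>
              (\<forall>i \<in> critical_positions \<sigma>. 2 \<le> b ! i)"
    using iff by blast
  have mem: "\<pi> \<in> residual_inflations \<delta> n \<sigma> \<longleftrightarrow>
      (\<exists>b \<in> block_sizes \<sigma> n. \<pi> = inflation \<sigma> b \<and> \<pi> \<in> residuals \<delta> n)"
    if "\<sigma> \<in> reduced_bases" for \<sigma> \<pi>
    using iff[OF that] unfolding residual_inflations_def by blast
  show "residuals \<delta> n = (\<Union>\<sigma> \<in> reduced_bases. residual_inflations \<delta> n \<sigma>)"
  proof (intro set_eqI iffI)
    fix \<pi> assume res: "\<pi> \<in> residuals \<delta> n"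
    obtain \<sigma> b where \<sigma>: "\<sigma> \<in> reduced_bases" "b \<in> block_sizes \<sigma> n" "\<pi> = inflation \<sigma> b"
      by (rule residual_is_inflation[OF assms res])
    then have "\<pi> \<in> residual_inflations \<delta> n \<sigma>"
      unfolding mem[OF \<sigma>(1)] using res by (intro bexI[of _ b]) simp_all
    then show "\<pi> \<in> (\<Union>\<sigma> \<in> reduced_bases. residual_inflations \<delta> n \<sigma>)"
      using \<sigma>(1) by (rule UN_I[rotated])
  next
    fix \<pi> assume "\<pi> \<in> (\<Union>\<sigma> \<in> reduced_bases. residual_inflations \<delta> n \<sigma>)"
    then obtain \<sigma> where \<sigma>: "\<sigma> \<in> reduced_bases" "\<pi> \<in> residual_inflations \<delta> n \<sigma>" by (rule UN_E)
    show "\<pi> \<in> residuals \<delta> n" using \<sigma>(2) unfolding mem[OF \<sigma>(1)] by fast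
  qed
  show "disjoint_family_on (residual_inflations \<delta> n) reduced_bases"
    unfolding disjoint_family_on_def
  proof (intro ballI impI)
    fix \<sigma> \<tau> assume st: "\<sigma> \<in> reduced_bases" "\<tau> \<in> reduced_bases" "\<sigma> \<noteq> \<tau>"
    have False if \<pi>: "\<pi> \<in> residual_inflations \<delta> n \<sigma>" "\<pi> \<in> residual_inflations \<delta> n \<tau>" for \<pi>
    proof -
      obtain b where b: "b \<in> block_sizes \<sigma> n" "\<pi> = inflation \<sigma> b"
        using \<pi>(1) unfolding mem[OF st(1)] by fast
      obtain c where c: "c \<in> block_sizes \<tau> n" "\<pi> = inflation \<tau> c"
        using \<pi>(2) unfolding mem[OF st(2)] by fast
      have "\<sigma> = \<tau>"
        using inflation_eq_imp_base_eq[OF st(1) b(1) st(2) c(1)] assms b(2) c(2) by simp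
      with st(3) show False by simp
    qed
    then show "residual_inflations \<delta> n \<sigma> \<inter> residual_inflations \<delta> n \<tau> = {}" by blast
  qed
qed

end
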